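(* Let $n\ge 2$, let $0<w_1<\dots<w_n$ be real numbers, let $H_1,\dots,H_n$ be non-zero complex constants, and let $$f(z)=1+H_1e^{w_1z}+\cdots+H_ne^{w_nz},\qquad z\in\mathbb{C}.$$ Then all zeros of $f$ lie in finitely many critical strips $\Lambda(j,k)$ of $f$. Moreover, let $\Lambda(j,k)$ be a critical strip of $f$, and let $R$ be any rectangle cut from $\Lambda(j,k)$ by two horizontal lines $\operatorname{Im}(z)=y_1$ and $\operatorname{Im}(z)=y_2$ with $y_2-y_1=r>0$, that is, $R=\{z\in\Lambda(j,k): y_1\le \operatorname{Im}(z)\le y_2\}$. Then the number $n(r,\Lambda_{jk})$ of zeros of $f$ in $R$ satisfies $$n(r,\Lambda_{jk})=\frac{|w_j-w_k|}{2\pi}\,r+O(1),$$ where the $O(1)$ term is bounded in absolute value by a constant depending only on $f$ (not on $r$ or $y_1$).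
   Context: Put $H_0=1$ and $w_0=0$. For $k\in\{0,1,\dots,n\}$, consider the inequality in $x\in\mathbb{R}$ $$|H_k|e^{w_kx}>\sum_{0\le l\le n,\ l\ne k}|H_l|e^{w_lx}.$$ For each $k$, the set of $x\in\mathbb{R}$ satisfying this inequality is an open (possibly empty) interval $I_k$. When $I_k$ is non-empty, the vertical strip $\{z: \operatorname{Re}(z)\in I_k\}$ is called a zero-free region of $f$ with dominating term $H_ke^{w_kz}$. The intervals $I_k$ are pairwise disjoint; $I_0$ is unbounded to the left and $I_n$ is unbounded to the right. The closed region between two consecutive (adjacent, in the left-to-right order) zero-free regions, with dominating terms $H_je^{w_jz}$ and $H_ke^{w_kz}$, $j\neq k$, is called a critical strip of $f$ and is denoted $\Lambda(j,k)$; it is a closed vertical strip containing its vertical boundary lines. Zeros are counted with multiplicity. *)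

theory Defs
  imports "HOL-Complex_Analysis.Complex_Analysis"
begin

definition exp_sum :: "nat \<Rightarrow> (nat \<Rightarrow> real) \<Rightarrow> (nat \<Rightarrow> complex) \<Rightarrow> complex \<Rightarrow> complex" where
  "exp_sum n w H z = 1 + (\<Sum>k=1..n. H k * exp (of_real (w k) * z))"

(* The following notions use the terms with indices 0..n; they describe exp_sum n w H
   under the convention w 0 = 0 and H 0 = 1. *)

definition dom_interval :: "nat \<Rightarrow> (nat \<Rightarrow> real) \<Rightarrow> (nat \<Rightarrow> complex) \<Rightarrow> nat \<Rightarrow> real set" where
  "dom_interval n w H k =
     {x. cmod (H k) * exp (w k * x) > (\<Sum>l\<in>{0..n} - {k}. cmod (H l) * exp (w l * x))}"

(* Empty if no x satisfies the inequality; only the non-empty ones count as regions below. *)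
definition zero_free_region :: "nat \<Rightarrow> (nat \<Rightarrow> real) \<Rightarrow> (nat \<Rightarrow> complex) \<Rightarrow> nat \<Rightarrow> complex set" where
  "zero_free_region n w H k = {z. Re z \<in> dom_interval n w H k}"

definition left_of :: "complex set \<Rightarrow> complex set \<Rightarrow> bool" where
  "left_of A B \<longleftrightarrow> (\<forall>a\<in>A. \<forall>b\<in>B. Re a < Re b)"

definition next_region :: "nat \<Rightarrow> (nat \<Rightarrow> real) \<Rightarrow> (nat \<Rightarrow> complex) \<Rightarrow> nat \<Rightarrow> nat \<Rightarrow> bool" where
  "next_region n w H j k \<longleftrightarrow>
     j \<le> n \<and> k \<le> n \<and> zero_free_region n w H j \<noteq> {} \<and> zero_free_region n w H k \<noteq> {} \<and>
     left_of (zero_free_region n w H j) (zero_free_region n w H k) \<and>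
     \<not> (\<exists>l\<le>n. zero_free_region n w H l \<noteq> {} \<and>
            left_of (zero_free_region n w H j) (zero_free_region n w H l) \<and>
            left_of (zero_free_region n w H l) (zero_free_region n w H k))"

definition adjacent_regions :: "nat \<Rightarrow> (nat \<Rightarrow> real) \<Rightarrow> (nat \<Rightarrow> complex) \<Rightarrow> nat \<Rightarrow> nat \<Rightarrow> bool" where
  "adjacent_regions n w H j k \<longleftrightarrow> next_region n w H j k \<or> next_region n w H k j"

(* The closed region between two zero-free regions, in either order: the points whose real
   part lies weakly between those of any point of one region and any point of the other.
   Meaningful only for adjacent regions. *)
definition critical_strip :: "nat \<Rightarrow> (nat \<Rightarrow> real) \<Rightarrow> (nat \<Rightarrow> complex) \<Rightarrow> nat \<Rightarrow> nat \<Rightarrow> complex set" where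
  "critical_strip n w H j k =
     {z. \<forall>a\<in>zero_free_region n w H j. \<forall>b\<in>zero_free_region n w H k.
           Re z \<in> closed_segment (Re a) (Re b)}"

definition critical_strips :: "nat \<Rightarrow> (nat \<Rightarrow> real) \<Rightarrow> (nat \<Rightarrow> complex) \<Rightarrow> complex set set" where
  "critical_strips n w H = {critical_strip n w H j k |j k. adjacent_regions n w H j k}"

(* Zeros counted with multiplicity; the sum is 0 by convention if there are infinitely many
   zeros in S, so finiteness has to be stated separately. *)
definition zero_count :: "(complex \<Rightarrow> complex) \<Rightarrow> complex set \<Rightarrow> int" where
  "zero_count f S = (\<Sum>z | z \<in> S \<and> f z = 0. zorder f z)"

end

theory Submission
  imports Defs
begin

text \<open>
  Where one term \<open>H k * exp (w k * z)\<close> dominates the sum of all others in modulus, \<open>f\<close> cannot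
  vanish. By convexity the abscissas at which a given term dominates form an interval, so a zero
  is caught between the nearest such intervals on its left and on its right
  (\<open>zeros_in_critical_strips\<close>).

  For the count, the strip between adjacent regions with dominating indices \<open>j\<close> (left) and \<open>k\<close>
  (right) is enlarged to \<open>a \<le> Re z \<le> b\<close> with \<open>a\<close> and \<open>b\<close> inside these regions, which adds no zeros,
  and the argument principle is applied to the rectangle of height \<open>r\<close> over \<open>{a..b}\<close>. On the side
  \<open>Re z = a\<close> the function is \<open>H j * exp (w j * z)\<close> times a factor with values in the right
  half-plane, so its argument changes by \<open>w j * r\<close> up to \<open>pi\<close>; likewise by \<open>w k * r\<close> on the side
  \<open>Re z = b\<close> (\<open>log_derivative_integral_vertical\<close>). The difference of the two is the main term, and
  it is positive because the dominating exponent increases from left to right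
  (\<open>dominant_exponent_increases\<close>).

  The remaining point is a bound for the horizontal sides that does not depend on their height.
  There \<open>f'/f\<close> is bounded as soon as \<open>f\<close> is bounded below, and by a normal family argument on the
  vertical translates of \<open>f\<close> every window of height 1 contains a horizontal segment on which
  \<open>\<delta> \<le> cmod (f z)\<close>, with one \<open>\<delta>\<close> for all windows (\<open>horizontal_segment_bounded_below\<close>). Moving the
  horizontal sides to such segments costs a bounded amount. As there are finitely many pairs of
  regions, one constant serves all critical strips.
\<close>

section \<open>Zeros of entire functions in rectangles\<close>

lemma entire_finite_zeros_compact:
  assumes "f holomorphic_on UNIV" and "f p \<noteq> 0" and "compact K"
  shows "finite {z \<in> K. f z = 0}"
proof (cases "f constant_on UNIV")
  case True
  then have "{z \<in> K. f z = 0} = {}"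
    using assms(2) by (auto simp: constant_on_def)
  then show ?thesis by (simp only: finite.emptyI)
next
  case False
  then show ?thesis
    using holomorphic_compact_finite_zeros[OF assms(1) open_UNIV connected_UNIV assms(3)] by simp
qed

lemma entire_zorder_pos:
  assumes "f holomorphic_on UNIV" and "f p \<noteq> 0" and "f z = 0"
  shows "zorder f z > 0"
  using zorder_exist_zero[OF assms(1) open_UNIV connected_UNIV UNIV_I, of z] assms(2,3) by auto

lemma zero_count_nonneg:
  assumes "f holomorphic_on UNIV" and "f p \<noteq> 0"
  shows "zero_count f S \<ge> 0"
  unfolding zero_count_def
  using entire_zorder_pos[OF assms] by (intro sum_nonneg) (auto intro: less_imp_le)

lemma zero_count_mono:
  assumes "f holomorphic_on UNIV" and "f p \<noteq> 0" and "S \<subseteq> T" and "compact T"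
  shows "zero_count f S \<le> zero_count f T"
  unfolding zero_count_def
  using entire_zorder_pos[OF assms(1,2)] entire_finite_zeros_compact[OF assms(1,2,4)] assms(3)
  by (intro sum_mono2) (auto intro: less_imp_le)

text \<open>
  The contour has winding number 1 around every point of the open rectangle and 0 around every
  point off the closed one, so the residue sum of the argument principle is exactly the number
  of zeros, which cannot lie on the contour.
\<close>

lemma argument_principle_rectangle:
  assumes f: "f holomorphic_on UNIV"
    and le: "Re p < Re q" "Im p < Im q"
    and nz: "\<And>z. z \<in> path_image (rectpath p q) \<Longrightarrow> f z \<noteq> 0"
  shows "contour_integral (rectpath p q) (\<lambda>z. deriv f z / f z)
           = 2 * pi * \<i> * of_int (zero_count f (cbox p q))"
proof -
  \<comment> \<open>The argument principle needs an open domain around the contour that contains only finitely many zeros; any bounded open box around the rectangle will do.\<close>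
  define S where "S = box (p - (1 + \<i>)) (q + (1 + \<i>))"
  define Z where "Z = {z \<in> S. f z = 0}"
  have sub: "cbox p q \<subseteq> S"
    by (auto simp: S_def in_cbox_complex_iff in_box_complex_iff)
  have img: "path_image (rectpath p q) = cbox p q - box p q"
    using le by (intro path_image_rectpath_cbox_minus_box) auto
  have fp: "f p \<noteq> 0"
    using nz[of p] le by (simp add: path_image_rectpath)
  have finZ: "finite Z"
    unfolding Z_def
    by (rule finite_subset[OF _ entire_finite_zeros_compact[OF f fp compact_cbox]])
      (use box_subset_cbox in \<open>auto simp: S_def\<close>)
  have "contour_integral (rectpath p q) (\<lambda>z. deriv f z * 1 / f z)
      = 2 * pi * \<i> * (\<Sum>z | z \<in> S \<and> (f z = 0 \<or> z \<in> {}). winding_number (rectpath p q) z * 1 * zorder f z)"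
  proof (rule argument_principle)
    show "open S" "connected S"
      by (auto simp: S_def intro: convex_connected)
    show "f holomorphic_on S - {}"
      using f by (rule holomorphic_on_subset) auto
    show "path_image (rectpath p q) \<subseteq> S - {z \<in> S. f z = 0 \<or> z \<in> {}}"
      using nz sub img by auto
    show "\<forall>z. z \<notin> S \<longrightarrow> winding_number (rectpath p q) z = 0"
      using sub le by (auto intro!: winding_number_rectpath_outside)
    show "finite {z \<in> S. f z = 0 \<or> z \<in> {}}"
      using finZ by (simp add: Z_def)
  qed auto
  also have "(\<Sum>z | z \<in> S \<and> (f z = 0 \<or> z \<in> {}). winding_number (rectpath p q) z * 1 * zorder f z)
      = (\<Sum>z\<in>Z. winding_number (rectpath p q) z * zorder f z)"
    by (simp add: Z_def)
  also have "\<dots> = (\<Sum>z | z \<in> cbox p q \<and> f z = 0. of_int (zorder f z))"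
  proof (rule sum.mono_neutral_cong_right[OF finZ])
    show "{z. z \<in> cbox p q \<and> f z = 0} \<subseteq> Z"
      using sub by (auto simp: Z_def)
    show "\<forall>z\<in>Z - {z. z \<in> cbox p q \<and> f z = 0}. winding_number (rectpath p q) z * of_int (zorder f z) = 0"
      using le by (auto simp: Z_def intro!: winding_number_rectpath_outside)
    show "winding_number (rectpath p q) z * of_int (zorder f z) = of_int (zorder f z)"
      if "z \<in> {z. z \<in> cbox p q \<and> f z = 0}" for z
    proof -
      have "z \<in> box p q" using that nz img by auto
      then show ?thesis by (simp add: winding_number_rectpath)
    qed
  qed
  finally show ?thesis
    by (simp add: zero_count_def)
qed

section \<open>Logarithmic derivative on the sides of a rectangle\<close>

text \<open>
  On the line the quotient \<open>f z / (K * exp (\<alpha> * z))\<close> stays in the right half-plane, where \<open>Ln\<close>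
  is holomorphic. Hence \<open>\<alpha> * z + Ln (f z / (K * exp (\<alpha> * z)))\<close> is a primitive of \<open>f'/f\<close> there. The
  imaginary part of its linear term grows exactly by \<open>\<alpha> * (y2 - y1)\<close>, and the argument of the
  quotient varies by at most \<open>pi\<close>, however long the segment is.
\<close>

lemma log_derivative_integral_vertical:
  fixes f :: "complex \<Rightarrow> complex" and K :: complex and \<alpha> x y1 y2 :: real
  assumes f: "f holomorphic_on UNIV"
    and pos: "\<And>z::complex. Re z = x \<Longrightarrow> Re (f z / (K * exp (\<alpha> * z))) > 0"
  shows "\<exists>L. ((\<lambda>z. deriv f z / f z) has_contour_integral L) (linepath (Complex x y1) (Complex x y2))
             \<and> \<bar>Im L - \<alpha> * (y2 - y1)\<bar> \<le> pi"
proof -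
  define q where "q = (\<lambda>z::complex. f z / (K * exp (\<alpha> * z)))"
  define F where "F = (\<lambda>z::complex. \<alpha> * z + Ln (q z))"
  have der: "(F has_field_derivative deriv f z / f z) (at z within {z. Re z = x})"
    if z: "z \<in> {z. Re z = x}" for z :: complex
  proof -
    have qpos: "Re (q z) > 0" using pos z by (simp add: q_def)
    then have nz: "K \<noteq> 0" "f z \<noteq> 0" by (auto simp: q_def)
    have df: "(f has_field_derivative deriv f z) (at z within {z. Re z = x})"
      using f by (metis UNIV_I has_field_derivative_at_within holomorphic_derivI open_UNIV)
    show ?thesis
      unfolding F_def q_def
      \<comment> \<open>The side conditions ask that the quotient avoid the branch cut of \<open>Ln\<close>, which \<open>qpos\<close> ensures.\<close>
      apply (rule derivative_eq_intros df refl | use qpos nz in \<open>simp add: q_def complex_nonpos_Reals_iff; fail\<close>)+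
       apply (use qpos in \<open>auto simp: q_def complex_nonpos_Reals_iff\<close>)[1]
      using nz by (simp add: field_simps)
  qed
  let ?u = "Complex x y1" and ?v = "Complex x y2"
  have "((\<lambda>z. deriv f z / f z) has_contour_integral F ?v - F ?u) (linepath ?u ?v)"
    using contour_integral_primitive[OF der, of "linepath ?u ?v"]
    by (auto simp: closed_segment_same_Re)
  moreover have "\<bar>Im (Ln (q z))\<bar> < pi / 2" if "Re z = x" for z
    using pos[OF that] by (subst Re_Ln_pos_lt) (auto simp: q_def)
  from this[of ?u] this[of ?v] have "\<bar>Im (F ?v - F ?u) - \<alpha> * (y2 - y1)\<bar> \<le> pi"
    unfolding F_def by simp argo
  ultimately show ?thesis by blast
qed

text \<open>
  If no \<open>\<delta>\<close> worked, there would be windows \<open>{Y m..Y m + 1}\<close> in which every horizontal segment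
  across the strip carries a value of \<open>f\<close> of modulus below \<open>1 / (m + 1)\<close>. The vertical translates
  of \<open>f\<close> by \<open>Y m\<close> form a normal family, because \<open>f\<close> is bounded on vertical strips; let \<open>g\<close> be a
  limit of a subsequence. The lower bound \<open>c\<close> on the line \<open>Re z = a\<close> passes to \<open>g\<close>, so \<open>g\<close> is not
  identically zero and has finitely many zeros in the limiting window. Some horizontal segment
  avoids all of them, and uniform convergence on that segment gives a contradiction.
\<close>

lemma horizontal_segment_bounded_below:
  fixes f :: "complex \<Rightarrow> complex" and a b :: real
  assumes f: "f holomorphic_on UNIV"
    and bd: "\<And>u v. \<exists>B. \<forall>z. Re z \<in> {u..v} \<longrightarrow> cmod (f z) \<le> B"
    and c: "c > 0" "\<And>y. c \<le> cmod (f (Complex a y))"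
  shows "\<exists>\<delta>>0. \<forall>y. \<exists>t\<in>{y..y+1}. \<forall>x\<in>{a..b}. \<delta> \<le> cmod (f (Complex x t))"
proof (rule ccontr)
  assume "\<not> ?thesis"
  then have neg: "\<exists>y. \<forall>t\<in>{y..y+1}. \<exists>x\<in>{a..b}. cmod (f (Complex x t)) < \<delta>" if "\<delta> > 0" for \<delta>
    using that by (auto simp: not_le)
  have "\<exists>y. \<forall>t\<in>{y..y+1}. \<exists>x\<in>{a..b}. cmod (f (Complex x t)) < 1 / real (Suc m)" for m
    by (rule neg) auto
  then obtain Y where Y: "\<And>m t. t \<in> {Y m..Y m+1} \<Longrightarrow> \<exists>x\<in>{a..b}. cmod (f (Complex x t)) < 1 / real (Suc m)"
    by metis
  define T where "T = (\<lambda>y::real. \<lambda>z. f (z + \<i> * y))"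
  have holT: "T y holomorphic_on UNIV" for y
    unfolding T_def using f
    by (intro holomorphic_on_compose_gen[of "\<lambda>z. z + \<i> * of_real y" UNIV f UNIV, unfolded o_def] holomorphic_intros) auto
  have bdT: "\<exists>B. \<forall>h\<in>range T. \<forall>z\<in>K. cmod (h z) \<le> B" if "compact K" for K
  proof -
    obtain r where r: "\<And>z. z \<in> K \<Longrightarrow> cmod z \<le> r"
      using compact_imp_bounded[OF \<open>compact K\<close>] by (auto simp: bounded_iff)
    obtain B where B: "\<forall>z. Re z \<in> {-r..r} \<longrightarrow> cmod (f z) \<le> B" using bd by blast
    have "cmod (T y z) \<le> B" if "z \<in> K" for y z
    proof -
      have "\<bar>Re z\<bar> \<le> r" using r[OF that] abs_Re_le_cmod[of z] by linarith
      then show ?thesis using B by (auto simp: T_def abs_le_iff)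
    qed
    then show ?thesis by blast
  qed
  obtain g r where g: "g holomorphic_on UNIV" and r: "strict_mono (r::nat\<Rightarrow>nat)"
    and lim: "\<And>x. (\<lambda>n. T (Y (r n)) x) \<longlonglongrightarrow> g x"
    and ulim: "\<And>K. compact K \<Longrightarrow> uniform_limit K ((\<lambda>n. T (Y n)) \<circ> r) g sequentially"
    using Montel[of UNIV "range T" "\<lambda>n. T (Y n)"] holT bdT by (auto simp: image_subset_iff)
  have "c \<le> cmod (g (of_real a))"
  proof (rule tendsto_lowerbound[OF tendsto_norm[OF lim]])
    have "of_real a + \<i> * of_real y = Complex a y" for y by (simp add: complex_eq_iff)
    then show "\<forall>\<^sub>F n in sequentially. c \<le> cmod (T (Y (r n)) (of_real a))"
      using c(2) by (simp add: T_def)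
  qed auto
  then have ga: "g (of_real a) \<noteq> 0" using c(1) by auto
  define Q where "Q = cbox (Complex a 0) (Complex b 1)"
  have "finite {z \<in> Q. g z = 0}"
    unfolding Q_def using g ga by (rule entire_finite_zeros_compact) auto
  then have "infinite ({0..1::real} - Im ` {z \<in> Q. g z = 0})"
    by (intro Diff_infinite_finite finite_imageI) (auto simp: infinite_Icc)
  then have "{0..1::real} - Im ` {z \<in> Q. g z = 0} \<noteq> {}"
    using finite.emptyI by metis
  then obtain t where t: "t \<in> {0..1}" "t \<notin> Im ` {z \<in> Q. g z = 0}"
    by blast
  have gnz: "g (Complex x t) \<noteq> 0" if "x \<in> {a..b}" for x
  proof
    assume "g (Complex x t) = 0"
    then have "Complex x t \<in> {z \<in> Q. g z = 0}"
      using t(1) that by (simp add: Q_def in_cbox_complex_iff)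
    from imageI[OF this, of Im] show False using t(2) by simp
  qed
  define L where "L = closed_segment (Complex a t) (Complex b t)"
  show False
  proof (cases "a \<le> b")
    case False
    then show False using Y[of "Y 0" 0] by auto
  next
    case ab: True
    have L: "z \<in> L \<longleftrightarrow> (\<exists>x\<in>{a..b}. z = Complex x t)" for z
      using ab by (auto simp: L_def closed_segment_same_Im closed_segment_eq_real_ivl complex_eq_iff)
    have "continuous_on L (\<lambda>z. cmod (g z))"
      using holomorphic_on_imp_continuous_on[OF g] by (intro continuous_intros) (auto intro: continuous_on_subset)
    moreover have "compact L" "L \<noteq> {}" by (auto simp: L_def)
    ultimately obtain z0 where z0: "z0 \<in> L" "\<And>z. z \<in> L \<Longrightarrow> cmod (g z0) \<le> cmod (g z)"
      using continuous_attains_inf[of L "\<lambda>z. cmod (g z)"] by auto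
    define \<epsilon> where "\<epsilon> = cmod (g z0) / 2"
    have eps: "\<epsilon> > 0" using z0(1) L gnz by (auto simp: \<epsilon>_def)
    have "\<forall>\<^sub>F n in sequentially. \<forall>z\<in>L. dist (((\<lambda>n. T (Y n)) \<circ> r) n z) (g z) < \<epsilon>"
      using uniform_limitD[OF ulim[OF \<open>compact L\<close>] eps] .
    moreover have "\<forall>\<^sub>F n in sequentially. 1 / real (Suc n) < \<epsilon>"
      using eps by real_asymp
    ultimately have "\<forall>\<^sub>F n in sequentially. False"
    proof eventually_elim
      case (elim n)
      obtain x where x: "x \<in> {a..b}" "cmod (f (Complex x (Y (r n) + t))) < 1 / real (Suc (r n))"
        using Y[of "Y (r n) + t" "r n"] t(1) by auto
      have xL: "Complex x t \<in> L" using L x(1) by auto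
      have "T (Y (r n)) (Complex x t) = f (Complex x (Y (r n) + t))"
        unfolding T_def by (rule arg_cong[of _ _ f]) (simp add: complex_eq_iff)
      then have "cmod (T (Y (r n)) (Complex x t)) < 1 / real (Suc (r n))"
        using x(2) by simp
      moreover have "n \<le> r n" using r by (rule seq_suble)
      then have "1 / real (Suc (r n)) \<le> 1 / real (Suc n)" by (simp add: field_simps)
      moreover have "cmod (T (Y (r n)) (Complex x t) - g (Complex x t)) < \<epsilon>"
        using elim(1) xL by (auto simp: dist_norm)
      moreover have "2 * \<epsilon> \<le> cmod (g (Complex x t))" using z0(2)[OF xL] by (simp add: \<epsilon>_def)
      moreover have "cmod (g (Complex x t)) \<le> cmod (T (Y (r n)) (Complex x t) - g (Complex x t)) + cmod (T (Y (r n)) (Complex x t))"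
        by (metis norm_minus_commute norm_triangle_sub add.commute)
      ultimately show False using elim(2) by linarith
    qed
    then show False by simp
  qed
qed

text \<open>
  Cauchy's estimate on discs of radius 1: a bound for \<open>f\<close> on the strip widened by 1 on both sides
  is a bound for the derivative.
\<close>

lemma deriv_bounded_on_strip:
  fixes f :: "complex \<Rightarrow> complex"
  assumes f: "f holomorphic_on UNIV"
    and bd: "\<And>u v. \<exists>B. \<forall>z. Re z \<in> {u..v} \<longrightarrow> cmod (f z) \<le> B"
  shows "\<exists>M. \<forall>z. Re z \<in> {a..b} \<longrightarrow> cmod (deriv f z) \<le> M"
proof -
  obtain B where B: "\<And>z. Re z \<in> {a-1..b+1} \<Longrightarrow> cmod (f z) \<le> B" using bd by blast
  have "cmod (deriv f z) \<le> B" if z: "Re z \<in> {a..b}" for z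
  proof -
    have "cmod ((deriv ^^ 1) f z) \<le> fact 1 * B / 1 ^ 1"
    proof (rule Cauchy_inequality)
      show "f holomorphic_on ball z 1" using f by (rule holomorphic_on_subset) auto
      show "continuous_on (cball z 1) f"
        using holomorphic_on_imp_continuous_on[OF f] by (rule continuous_on_subset) auto
      show "cmod (f w) \<le> B" if "cmod (z - w) = 1" for w
        using that z abs_Re_le_cmod[of "z - w"] by (intro B) auto
    qed auto
    then show ?thesis by simp
  qed
  then show ?thesis by blast
qed

section \<open>Counting zeros in a strip\<close>

text \<open>
  In the argument principle the two vertical sides contribute \<open>(\<beta> - \<alpha>) * (t - s)\<close> to the imaginary
  part of the contour integral, each up to an error \<open>pi\<close>, and each horizontal side contributes at
  most \<open>M / \<delta> * (b - a)\<close>. None of the errors depends on the height of the rectangle. Division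
  by \<open>2 * pi\<close> gives the stated bound.
\<close>

lemma zero_count_rectangle_clear_edges:
  fixes f :: "complex \<Rightarrow> complex" and K K' :: complex and a b s t \<alpha> \<beta> \<delta> M :: real
  assumes f: "f holomorphic_on UNIV" and ab: "a < b" and st: "s < t"
    and left: "\<And>z::complex. Re z = a \<Longrightarrow> Re (f z / (K * exp (\<alpha> * z))) > 0"
    and right: "\<And>z::complex. Re z = b \<Longrightarrow> Re (f z / (K' * exp (\<beta> * z))) > 0"
    and \<delta>: "\<delta> > 0"
    and low: "\<And>x y. x \<in> {a..b} \<Longrightarrow> y \<in> {s, t} \<Longrightarrow> \<delta> \<le> cmod (f (Complex x y))"
    and M: "\<And>z. Re z \<in> {a..b} \<Longrightarrow> cmod (deriv f z) \<le> M"
  shows "\<bar>real_of_int (zero_count f (cbox (Complex a s) (Complex b t))) - (\<beta> - \<alpha>) / (2 * pi) * (t - s)\<bar>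
           \<le> 1 + M * (b - a) / (pi * \<delta>)"
proof -
  let ?g = "\<lambda>z. deriv f z / f z"
  let ?p1 = "Complex a s" and ?p2 = "Complex b s" and ?p3 = "Complex b t" and ?p4 = "Complex a t"
  define N where "N = real_of_int (zero_count f (cbox ?p1 ?p3))"
  have edge: "f z \<noteq> 0" if "Re z \<in> {a, b} \<or> (Im z \<in> {s, t} \<and> Re z \<in> {a..b})" for z
    using that left[of z] right[of z] low[of "Re z" "Im z"] \<delta> by (cases z) force
  have M0: "M \<ge> 0" using M[of a] ab by (smt (verit) Re_complex_of_real atLeastAtMost_iff norm_ge_zero)
  have hor: "?g contour_integrable_on linepath (Complex u y) (Complex v y) \<and>
      \<bar>Im (contour_integral (linepath (Complex u y) (Complex v y)) ?g)\<bar> \<le> M / \<delta> * (b - a)"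
    if y: "y \<in> {s, t}" and uv: "u \<in> {a, b}" "v \<in> {a, b}" "u \<noteq> v" for u v y
  proof -
    have seg: "Im z = y \<and> Re z \<in> {a..b}" if "z \<in> closed_segment (Complex u y) (Complex v y)" for z
      using that uv ab by (auto simp: closed_segment_same_Im closed_segment_eq_real_ivl split: if_splits)
    have int: "?g contour_integrable_on linepath (Complex u y) (Complex v y)"
    proof (rule contour_integrable_continuous_linepath)
      have "continuous_on UNIV f" "continuous_on UNIV (deriv f)"
        using f by (auto intro!: holomorphic_on_imp_continuous_on holomorphic_deriv)
      then show "continuous_on (closed_segment (Complex u y) (Complex v y)) ?g"
        using edge seg y by (intro continuous_on_divide) (auto intro: continuous_on_subset)
    qed
    have "cmod (contour_integral (linepath (Complex u y) (Complex v y)) ?g)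
            \<le> M / \<delta> * cmod (Complex v y - Complex u y)"
    proof (rule contour_integral_bound_linepath[OF int])
      show "cmod (?g z) \<le> M / \<delta>" if "z \<in> closed_segment (Complex u y) (Complex v y)" for z
        using seg[OF that] low[of "Re z" "Im z"] M[of z] \<delta> y M0
        by (auto simp: norm_divide intro!: frac_le)
    qed (use M0 \<delta> in auto)
    also have "cmod (Complex v y - Complex u y) = b - a"
      using uv ab by (auto simp: cmod_def)
    finally show ?thesis
      using int abs_Im_le_cmod order_trans by blast
  qed
  have right': "\<exists>L. (?g has_contour_integral L) (linepath ?p2 ?p3) \<and> \<bar>Im L - \<beta> * (t - s)\<bar> \<le> pi"
    using log_derivative_integral_vertical[OF f right] .
  have left': "\<exists>L. (?g has_contour_integral L) (linepath ?p4 ?p1) \<and> \<bar>Im L - \<alpha> * (s - t)\<bar> \<le> pi"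
    using log_derivative_integral_vertical[OF f left] .
  obtain R where R: "(?g has_contour_integral R) (linepath ?p2 ?p3)" "\<bar>Im R - \<beta> * (t - s)\<bar> \<le> pi"
    using right' by blast
  obtain L where L: "(?g has_contour_integral L) (linepath ?p4 ?p1)" "\<bar>Im L - \<alpha> * (s - t)\<bar> \<le> pi"
    using left' by blast
  define B where "B = contour_integral (linepath ?p1 ?p2) ?g"
  define T where "T = contour_integral (linepath ?p3 ?p4) ?g"
  have B: "(?g has_contour_integral B) (linepath ?p1 ?p2)" "\<bar>Im B\<bar> \<le> M / \<delta> * (b - a)"
    using hor[of s a b] ab by (auto simp: B_def has_contour_integral_integral)
  have T: "(?g has_contour_integral T) (linepath ?p3 ?p4)" "\<bar>Im T\<bar> \<le> M / \<delta> * (b - a)"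
    using hor[of t b a] ab by (auto simp: T_def has_contour_integral_integral)
  have "(?g has_contour_integral (B + (R + (T + L)))) (rectpath ?p1 ?p3)"
    unfolding rectpath_def Let_def complex.sel
    by (intro has_contour_integral_join B(1) R(1) T(1) L(1)) auto
  then have "contour_integral (rectpath ?p1 ?p3) ?g = B + R + T + L"
    by (simp add: contour_integral_unique)
  moreover have "contour_integral (rectpath ?p1 ?p3) ?g = 2 * pi * \<i> * of_int (zero_count f (cbox ?p1 ?p3))"
    using ab st edge by (intro argument_principle_rectangle[OF f]) (auto simp: path_image_rectpath)
  ultimately have "B + R + T + L = 2 * pi * \<i> * of_int (zero_count f (cbox ?p1 ?p3))" by simp
  from arg_cong[OF this, of Im] have "Im B + Im R + Im T + Im L = 2 * pi * N"
    by (simp add: N_def)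
  then have eq: "2 * pi * N - (\<beta> - \<alpha>) * (t - s)
      = Im B + Im T + (Im R - \<beta> * (t - s)) + (Im L - \<alpha> * (s - t))"
    by (simp add: algebra_simps)
  have "\<bar>2 * pi * N - (\<beta> - \<alpha>) * (t - s)\<bar> \<le> 2 * pi + 2 * (M / \<delta> * (b - a))"
    unfolding eq using B(2) T(2) R(2) L(2) by linarith
  then have "\<bar>2 * pi * N - (\<beta> - \<alpha>) * (t - s)\<bar> / (2 * pi) \<le> (2 * pi + 2 * (M / \<delta> * (b - a))) / (2 * pi)"
    by (intro divide_right_mono) auto
  also have "\<bar>2 * pi * N - (\<beta> - \<alpha>) * (t - s)\<bar> / (2 * pi) = \<bar>(2 * pi * N - (\<beta> - \<alpha>) * (t - s)) / (2 * pi)\<bar>"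
    by (simp add: abs_divide)
  also have "(2 * pi * N - (\<beta> - \<alpha>) * (t - s)) / (2 * pi) = N - (\<beta> - \<alpha>) / (2 * pi) * (t - s)"
    by (simp add: field_simps)
  also have "(2 * pi + 2 * (M / \<delta> * (b - a))) / (2 * pi) = 1 + M * (b - a) / (pi * \<delta>)"
    using \<delta> by (simp add: field_simps)
  finally show ?thesis by (simp add: N_def)
qed

text \<open>
  The given heights \<open>y1\<close> and \<open>y2\<close> may be bad, since zeros can lie on or near the horizontal sides.
  But within distance 1 of each there are heights at which \<open>f\<close> is bounded below by the same \<open>\<delta>\<close>.
  Moving the sides outwards to such heights bounds the count from above, moving them inwards
  bounds it from below, and the main term changes by at most \<open>2 * \<bar>\<kappa>\<bar>\<close> in either case.
\<close>

lemma zero_count_strip_asymptotics: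
  fixes f :: "complex \<Rightarrow> complex" and K K' :: complex and a b \<alpha> \<beta> c :: real
  assumes f: "f holomorphic_on UNIV" and ab: "a < b"
    and bd: "\<And>u v. \<exists>B. \<forall>z. Re z \<in> {u..v} \<longrightarrow> cmod (f z) \<le> B"
    and left: "\<And>z::complex. Re z = a \<Longrightarrow> Re (f z / (K * exp (\<alpha> * z))) > 0"
    and right: "\<And>z::complex. Re z = b \<Longrightarrow> Re (f z / (K' * exp (\<beta> * z))) > 0"
    and c: "c > 0" "\<And>y. c \<le> cmod (f (Complex a y))"
  shows "\<exists>C. \<forall>y1 y2. y1 < y2 \<longrightarrow>
           \<bar>real_of_int (zero_count f (cbox (Complex a y1) (Complex b y2))) - (\<beta> - \<alpha>) / (2 * pi) * (y2 - y1)\<bar> \<le> C"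
proof -
  obtain \<delta> where \<delta>: "\<delta> > 0"
    and window: "\<And>y. \<exists>t\<in>{y..y+1}. \<forall>x\<in>{a..b}. \<delta> \<le> cmod (f (Complex x t))"
    using horizontal_segment_bounded_below[OF f bd c, of b] by blast
  obtain M where M: "\<And>z. Re z \<in> {a..b} \<Longrightarrow> cmod (deriv f z) \<le> M"
    using deriv_bounded_on_strip[OF f bd, of a b] by blast
  define N where "N = (\<lambda>s t. real_of_int (zero_count f (cbox (Complex a s) (Complex b t))))"
  define \<kappa> where "\<kappa> = (\<beta> - \<alpha>) / (2 * pi)"
  define C where "C = 1 + M * (b - a) / (pi * \<delta>)"
  have fnz: "f (Complex a 0) \<noteq> 0" using c(1) c(2)[of 0] by auto
  have mono: "N s t \<le> N s' t'" if "s' \<le> s" "t \<le> t'" for s t s' t'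
    unfolding N_def using that
    by (intro of_int_le_iff[THEN iffD2] zero_count_mono[OF f fnz]) (auto simp: in_cbox_complex_iff)
  have nonneg: "0 \<le> N s t" for s t
    unfolding N_def using zero_count_nonneg[OF f fnz] by simp
  have good: "\<bar>N s t - \<kappa> * (t - s)\<bar> \<le> C"
    if "s < t" "\<forall>x\<in>{a..b}. \<delta> \<le> cmod (f (Complex x s))" "\<forall>x\<in>{a..b}. \<delta> \<le> cmod (f (Complex x t))" for s t
    unfolding N_def \<kappa>_def C_def
    by (rule zero_count_rectangle_clear_edges[OF f ab that(1) left right \<delta> _ M]) (use that in auto)
  have lin: "\<bar>\<kappa> * u - \<kappa> * v\<bar> \<le> 2 * \<bar>\<kappa>\<bar>" if "\<bar>u - v\<bar> \<le> 2" for u v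
  proof -
    have "\<bar>\<kappa> * u - \<kappa> * v\<bar> = \<bar>\<kappa>\<bar> * \<bar>u - v\<bar>" by (simp add: abs_mult flip: right_diff_distrib)
    also have "\<dots> \<le> \<bar>\<kappa>\<bar> * 2" using that by (intro mult_left_mono) auto
    finally show ?thesis by simp
  qed
  have "\<bar>N y1 y2 - \<kappa> * (y2 - y1)\<bar> \<le> C + 2 * \<bar>\<kappa>\<bar>" if y: "y1 < y2" for y1 y2
  proof -
    obtain s t where s: "s \<in> {y1-1..y1}" "\<forall>x\<in>{a..b}. \<delta> \<le> cmod (f (Complex x s))"
      and t: "t \<in> {y2..y2+1}" "\<forall>x\<in>{a..b}. \<delta> \<le> cmod (f (Complex x t))"
      using window[of "y1 - 1"] window[of y2] by auto
    have outer: "\<bar>N s t - \<kappa> * (t - s)\<bar> \<le> C" using good s t y by auto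
    have "\<bar>\<kappa> * (t - s) - \<kappa> * (y2 - y1)\<bar> \<le> 2 * \<bar>\<kappa>\<bar>" using s t by (intro lin) auto
    then have upper: "N y1 y2 \<le> \<kappa> * (y2 - y1) + (C + 2 * \<bar>\<kappa>\<bar>)"
      using mono[of s y1 y2 t] s(1) t(1) outer by auto
    have lower: "\<kappa> * (y2 - y1) - (C + 2 * \<bar>\<kappa>\<bar>) \<le> N y1 y2"
    \<comment> \<open>A low rectangle may leave no room to move both sides inwards, but then the main term is itself bounded.\<close>
    proof (cases "y2 - y1 \<le> 2")
      case True
      then have "\<bar>\<kappa> * (y2 - y1) - \<kappa> * 0\<bar> \<le> 2 * \<bar>\<kappa>\<bar>" using y by (intro lin) auto
      moreover have "0 \<le> C" using outer by linarith
      ultimately show ?thesis using nonneg[of y1 y2] by auto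
    next
      case False
      obtain s' t' where s': "s' \<in> {y1..y1+1}" "\<forall>x\<in>{a..b}. \<delta> \<le> cmod (f (Complex x s'))"
        and t': "t' \<in> {y2-1..y2}" "\<forall>x\<in>{a..b}. \<delta> \<le> cmod (f (Complex x t'))"
        using window[of y1] window[of "y2 - 1"] by auto
      have inner: "\<bar>N s' t' - \<kappa> * (t' - s')\<bar> \<le> C" using good s' t' False by auto
      have "\<bar>\<kappa> * (t' - s') - \<kappa> * (y2 - y1)\<bar> \<le> 2 * \<bar>\<kappa>\<bar>" using s' t' by (intro lin) auto
      then show ?thesis
        using mono[of y1 s' t' y2] s'(1) t'(1) inner by auto
    qed
    show ?thesis using upper lower by linarith
  qed
  then show ?thesis unfolding N_def \<kappa>_def by blast
qed

section \<open>Exponential sums and their zero-free regions\<close>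

lemma exp_sum_eq_sum:
  assumes "w 0 = 0" and "H 0 = 1"
  shows "exp_sum n w H z = (\<Sum>l\<in>{0..n}. H l * exp (of_real (w l) * z))"
  using assms by (simp add: exp_sum_def sum.atLeast_Suc_atMost)

lemma exp_sum_holomorphic: "exp_sum n w H holomorphic_on S"
  unfolding exp_sum_def by (intro holomorphic_intros)

lemma exp_sum_bounded_on_strip:
  "\<exists>B. \<forall>z. Re z \<in> {u..v} \<longrightarrow> cmod (exp_sum n w H z) \<le> B"
proof -
  define B where "B = 1 + (\<Sum>k=1..n. cmod (H k) * exp (\<bar>w k\<bar> * (\<bar>u\<bar> + \<bar>v\<bar>)))"
  have "cmod (exp_sum n w H z) \<le> B" if z: "Re z \<in> {u..v}" for z
  proof -
    have "w k * Re z \<le> \<bar>w k\<bar> * (\<bar>u\<bar> + \<bar>v\<bar>)" for k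
    proof -
      have "w k * Re z \<le> \<bar>w k\<bar> * \<bar>Re z\<bar>" by (metis abs_ge_self abs_mult)
      also have "\<dots> \<le> \<bar>w k\<bar> * (\<bar>u\<bar> + \<bar>v\<bar>)" using z by (intro mult_left_mono) auto
      finally show ?thesis .
    qed
    then have "cmod (\<Sum>k=1..n. H k * exp (of_real (w k) * z))
        \<le> (\<Sum>k=1..n. cmod (H k) * exp (\<bar>w k\<bar> * (\<bar>u\<bar> + \<bar>v\<bar>)))"
      by (intro sum_norm_le) (auto simp: norm_mult intro!: mult_left_mono)
    then show ?thesis
      unfolding exp_sum_def B_def
      using norm_triangle_ineq[of 1 "\<Sum>k=1..n. H k * exp (of_real (w k) * z)"] by simp
  qed
  then show ?thesis by blast
qed

text \<open>
  After division by \<open>exp (w k * x)\<close> the left-hand side is a convex function of \<open>x\<close>; this form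
  of the inequality shows that a dominance set is an interval and how it behaves at infinity.
\<close>

lemma dom_interval_iff:
  "x \<in> dom_interval n w H k \<longleftrightarrow>
     (\<Sum>l\<in>{0..n} - {k}. cmod (H l) * exp ((w l - w k) * x)) < cmod (H k)"
proof -
  have "(\<Sum>l\<in>{0..n} - {k}. cmod (H l) * exp (w l * x))
      = (\<Sum>l\<in>{0..n} - {k}. cmod (H l) * exp ((w l - w k) * x)) * exp (w k * x)"
    by (simp add: sum_distrib_right mult.assoc left_diff_distrib flip: exp_add)
  then show ?thesis by (simp add: dom_interval_def)
qed

lemma convex_dom_interval: "convex (dom_interval n w H k)"
proof (rule convexI)
  fix x y u v :: real
  assume x: "x \<in> dom_interval n w H k" and y: "y \<in> dom_interval n w H k"
    and uv: "0 \<le> u" "0 \<le> v" "u + v = 1"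
  let ?\<phi> = "\<lambda>x. \<Sum>l\<in>{0..n} - {k}. cmod (H l) * exp ((w l - w k) * x)"
  have exp_le: "exp (c * (u * x + v * y)) \<le> u * exp (c * x) + v * exp (c * y)" for c :: real
  proof -
    have "exp (u * (c * x) + v * (c * y)) \<le> u * exp (c * x) + v * exp (c * y)"
      using exp_convex uv unfolding convex_on_def by auto
    then show ?thesis by (simp add: algebra_simps)
  qed
  have "?\<phi> (u * x + v * y)
      \<le> (\<Sum>l\<in>{0..n} - {k}. cmod (H l) * (u * exp ((w l - w k) * x) + v * exp ((w l - w k) * y)))"
    by (intro sum_mono mult_left_mono exp_le) auto
  also have "\<dots> = u * ?\<phi> x + v * ?\<phi> y"
    by (simp add: sum_distrib_left sum.distrib algebra_simps)
  also have "\<dots> < cmod (H k)"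
    using x y uv convex_bound_lt[of "?\<phi> x" "cmod (H k)" "?\<phi> y" u v]
    by (simp add: dom_interval_iff)
  finally show "u *\<^sub>R x + v *\<^sub>R y \<in> dom_interval n w H k"
    by (simp add: dom_interval_iff)
qed

lemma dom_interval_one_sided:
  assumes "x \<notin> dom_interval n w H k"
  shows "(\<forall>a\<in>dom_interval n w H k. a < x) \<or> (\<forall>a\<in>dom_interval n w H k. x < a)"
proof (rule ccontr)
  assume "\<not> ?thesis"
  then obtain a b where "a \<in> dom_interval n w H k" "b \<in> dom_interval n w H k" "x \<le> a" "b \<le> x"
    by (auto simp: not_less)
  then show False
    using assms mem_is_interval_1_I[of "dom_interval n w H k" b a x] convex_dom_interval
    by (auto simp: is_interval_convex_1)
qed

lemma dom_interval_minimal_exponent: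
  assumes "\<And>l. l \<in> {0..n} - {k} \<Longrightarrow> w k < w l" and "H k \<noteq> 0"
  shows "dom_interval n w H k \<inter> {..x} \<noteq> {}"
proof -
  have "((\<lambda>x. \<Sum>l\<in>{0..n} - {k}. cmod (H l) * exp ((w l - w k) * x)) \<longlongrightarrow> 0) at_bot"
  proof (intro tendsto_null_sum tendsto_mult_right_zero)
    fix l assume "l \<in> {0..n} - {k}"
    then have "filterlim (\<lambda>x. (w l - w k) * x) at_bot at_bot"
      using assms(1) by (intro filterlim_tendsto_pos_mult_at_bot[OF tendsto_const] filterlim_ident) auto
    then show "((\<lambda>x. exp ((w l - w k) * x)) \<longlongrightarrow> 0) at_bot"
      by (rule filterlim_compose[OF exp_at_bot])
  qed
  then have "eventually (\<lambda>x. x \<in> dom_interval n w H k) at_bot"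
    unfolding dom_interval_iff using assms(2) by (intro order_tendstoD(2)) auto
  then have "\<exists>y. y \<le> x \<and> y \<in> dom_interval n w H k"
    unfolding eventually_at_bot_linorder by (meson min.cobounded1 min.cobounded2)
  then show ?thesis by auto
qed

lemma dom_interval_maximal_exponent:
  assumes "\<And>l. l \<in> {0..n} - {k} \<Longrightarrow> w l < w k" and "H k \<noteq> 0"
  shows "dom_interval n w H k \<inter> {x..} \<noteq> {}"
proof -
  have "dom_interval n (\<lambda>l. - w l) H k \<inter> {..-x} \<noteq> {}"
    by (rule dom_interval_minimal_exponent) (use assms in auto)
  then obtain y where "y \<le> - x" "y \<in> dom_interval n (\<lambda>l. - w l) H k" by auto
  then have "-y \<in> dom_interval n w H k \<inter> {x..}"
    by (simp add: dom_interval_def)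
  then show ?thesis by blast
qed

text \<open>
  At \<open>a\<close> the term with index \<open>j\<close> exceeds the one with index \<open>k\<close>, and at \<open>b\<close> it is the other way
  round. Multiplying the two inequalities cancels the coefficients and leaves
  \<open>(w k - w j) * (b - a) > 0\<close>.
\<close>

lemma dominant_exponent_increases:
  assumes "a \<in> dom_interval n w H j" and "b \<in> dom_interval n w H k" and "a < b"
    and "j \<le> n" and "k \<le> n" and "j \<noteq> k"
  shows "w j < w k"
proof -
  have dom: "cmod (H l) * exp (w l * x) < cmod (H i) * exp (w i * x)"
    if "x \<in> dom_interval n w H i" "l \<le> n" "l \<noteq> i" for x i l
  proof -
    have "cmod (H l) * exp (w l * x) \<le> (\<Sum>l\<in>{0..n} - {i}. cmod (H l) * exp (w l * x))"
      using that by (intro member_le_sum) auto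
    then show ?thesis using that(1) by (auto simp: dom_interval_def)
  qed
  have "(cmod (H k) * exp (w k * a)) * (cmod (H j) * exp (w j * b))
      < (cmod (H j) * exp (w j * a)) * (cmod (H k) * exp (w k * b))"
    using assms(4-6) by (intro mult_strict_mono'[OF dom[OF assms(1)] dom[OF assms(2)]]) auto
  then have "(cmod (H j) * cmod (H k)) * exp (w k * a + w j * b)
      < (cmod (H j) * cmod (H k)) * exp (w j * a + w k * b)"
    by (simp add: exp_add mult_ac)
  then have "w k * a + w j * b < w j * a + w k * b"
    by (metis exp_less_cancel_iff mult_less_cancel_left_disj mult_nonneg_nonneg norm_ge_zero not_less)
  then have "(w k - w j) * (b - a) > 0" by (simp add: algebra_simps)
  then show ?thesis using assms(3) by (simp add: zero_less_mult_iff)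
qed

lemma exp_sum_dominated:
  assumes "w 0 = 0" and "H 0 = 1" and k: "k \<le> n"
  shows "cmod (exp_sum n w H z - H k * exp (w k * z))
           \<le> (\<Sum>l\<in>{0..n} - {k}. cmod (H l) * exp (w l * Re z))"
proof -
  have "exp_sum n w H z - H k * exp (w k * z) = (\<Sum>l\<in>{0..n} - {k}. H l * exp (of_real (w l) * z))"
    using k by (simp add: exp_sum_eq_sum[of w H, OF assms(1,2)] sum.remove[of "{0..n}" k])
  also have "cmod \<dots> \<le> (\<Sum>l\<in>{0..n} - {k}. cmod (H l) * exp (w l * Re z))"
    by (intro sum_norm_le) (simp add: norm_mult)
  finally show ?thesis .
qed

text \<open>
  Where one term dominates, the quotient of the sum by that term lies in the open unit disc around
  1. So it has positive real part, which is what the estimates on vertical lines need.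
\<close>

lemma Re_exp_sum_quotient_pos:
  assumes "w 0 = 0" and "H 0 = 1" and "k \<le> n" and z: "Re z \<in> dom_interval n w H k"
  shows "Re (exp_sum n w H z / (H k * exp (w k * z))) > 0"
proof -
  let ?d = "H k * exp (w k * z)"
  have less: "cmod (exp_sum n w H z - ?d) < cmod ?d"
    using exp_sum_dominated[of w H, OF assms(1-3), of z] z by (simp add: dom_interval_def norm_mult)
  then have "?d \<noteq> 0" by auto
  then have "cmod (exp_sum n w H z / ?d - 1) = cmod (exp_sum n w H z - ?d) / cmod ?d"
    by (simp add: diff_divide_distrib flip: norm_divide)
  also have "\<dots> < 1" using less \<open>?d \<noteq> 0\<close> by simp
  finally have "cmod (exp_sum n w H z / ?d - 1) < 1" .
  then show ?thesis
    using abs_Re_le_cmod[of "exp_sum n w H z / ?d - 1"] by simp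
qed

lemma exp_sum_nonzero_in_region:
  assumes "w 0 = 0" and "H 0 = 1" and "k \<le> n" and "Re z \<in> dom_interval n w H k"
  shows "exp_sum n w H z \<noteq> 0"
  using Re_exp_sum_quotient_pos[of w H, OF assms] by auto

lemma exp_sum_bounded_below_on_vertical_line:
  assumes "w 0 = 0" and "H 0 = 1" and "k \<le> n" and a: "a \<in> dom_interval n w H k"
  obtains c where "c > 0" and "\<And>y. c \<le> cmod (exp_sum n w H (Complex a y))"
proof
  let ?S = "\<Sum>l\<in>{0..n} - {k}. cmod (H l) * exp (w l * a)"
  show "cmod (H k) * exp (w k * a) - ?S > 0"
    using a by (simp add: dom_interval_def)
  show "cmod (H k) * exp (w k * a) - ?S \<le> cmod (exp_sum n w H (Complex a y))" for y
  proof -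
    let ?z = "Complex a y" and ?d = "H k * exp (w k * Complex a y)"
    have "cmod ?d \<le> cmod (exp_sum n w H ?z) + cmod (exp_sum n w H ?z - ?d)"
      by (metis norm_minus_commute norm_triangle_sub)
    moreover have "cmod (exp_sum n w H ?z - ?d) \<le> ?S"
      using exp_sum_dominated[of w H, OF assms(1-3), of ?z] by simp
    ultimately show ?thesis by (simp add: norm_mult)
  qed
qed

section \<open>Critical strips\<close>

lemma Re_image_zero_free_region: "Re ` zero_free_region n w H k = dom_interval n w H k"
proof
  show "dom_interval n w H k \<subseteq> Re ` zero_free_region n w H k"
  proof
    fix x assume "x \<in> dom_interval n w H k"
    then show "x \<in> Re ` zero_free_region n w H k"
      by (intro image_eqI[of _ _ "of_real x"]) (simp_all add: zero_free_region_def)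
  qed
qed (auto simp: zero_free_region_def)

lemma zero_free_region_empty_iff: "zero_free_region n w H k = {} \<longleftrightarrow> dom_interval n w H k = {}"
  by (simp flip: Re_image_zero_free_region)

lemma left_of_zero_free_region_iff:
  "left_of (zero_free_region n w H j) (zero_free_region n w H k)
     \<longleftrightarrow> (\<forall>a\<in>dom_interval n w H j. \<forall>b\<in>dom_interval n w H k. a < b)"
  by (simp add: left_of_def flip: Re_image_zero_free_region)

lemma critical_strip_commute: "critical_strip n w H j k = critical_strip n w H k j"
proof -
  have "z \<in> critical_strip n w H k j" if z: "z \<in> critical_strip n w H j k" for j k z
    unfolding critical_strip_def
  proof (intro CollectI ballI)
    fix a b assume "a \<in> zero_free_region n w H k" "b \<in> zero_free_region n w H j"
    then have "Re z \<in> closed_segment (Re b) (Re a)"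
      using z unfolding critical_strip_def by blast
    then show "Re z \<in> closed_segment (Re a) (Re b)" by (subst closed_segment_commute)
  qed
  then show ?thesis by blast
qed

lemma critical_strip_eq:
  assumes "next_region n w H j k"
  shows "critical_strip n w H j k =
           {z. \<forall>a\<in>dom_interval n w H j. \<forall>b\<in>dom_interval n w H k. a \<le> Re z \<and> Re z \<le> b}"
proof -
  have "Re z \<in> closed_segment (Re a) (Re b) \<longleftrightarrow> Re a \<le> Re z \<and> Re z \<le> Re b"
    if "a \<in> zero_free_region n w H j" "b \<in> zero_free_region n w H k" for a b z
  proof -
    have "Re a < Re b" using that assms by (auto simp: next_region_def left_of_def)
    then show ?thesis by (simp add: closed_segment_eq_real_ivl)
  qed
  then have "critical_strip n w H j k = {z. \<forall>a\<in>zero_free_region n w H j.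
      \<forall>b\<in>zero_free_region n w H k. Re a \<le> Re z \<and> Re z \<le> Re b}"
    by (auto simp: critical_strip_def)
  also have "\<dots> = {z. \<forall>a\<in>dom_interval n w H j. \<forall>b\<in>dom_interval n w H k. a \<le> Re z \<and> Re z \<le> b}"
    by (simp flip: Re_image_zero_free_region)
  finally show ?thesis .
qed

lemma finite_critical_strips: "finite (critical_strips n w H)"
proof (rule finite_subset)
  show "critical_strips n w H \<subseteq> (\<lambda>(j, k). critical_strip n w H j k) ` ({..n} \<times> {..n})"
    by (auto simp: critical_strips_def adjacent_regions_def next_region_def)
qed auto

text \<open>
  At a zero no term dominates, so each non-empty dominance interval lies entirely to the left or
  entirely to the right of \<open>Re z\<close>. The smallest exponent gives one on the left and the largest one
  on the right. The rightmost interval on the left and the leftmost on the right are then adjacent,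
  and \<open>z\<close> lies between them.
\<close>

lemma zeros_in_critical_strips:
  assumes w0: "w 0 = 0" and H0: "H 0 = 1"
    and least: "\<And>l. l \<in> {0..n} - {0} \<Longrightarrow> w 0 < w l"
    and greatest: "\<And>l. l \<in> {0..n} - {n} \<Longrightarrow> w l < w n"
    and Hn: "H n \<noteq> 0"
    and z: "exp_sum n w H z = 0"
  shows "z \<in> \<Union> (critical_strips n w H)"
proof -
  let ?I = "dom_interval n w H"
  define L where "L = {k. k \<le> n \<and> ?I k \<noteq> {} \<and> (\<forall>a\<in>?I k. a < Re z)}"
  define R where "R = {k. k \<le> n \<and> ?I k \<noteq> {} \<and> (\<forall>a\<in>?I k. Re z < a)}"
  have side: "k \<in> L \<or> k \<in> R" if "k \<le> n" "?I k \<noteq> {}" for k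
    using that z exp_sum_nonzero_in_region[of w H, OF w0 H0, of k n z] dom_interval_one_sided[of "Re z" n w H k]
    by (auto simp: L_def R_def)
  \<comment> \<open>One chosen point per interval suffices to find the intervals nearest to the zero.\<close>
  define p where "p = (\<lambda>k. SOME a. a \<in> ?I k)"
  have p: "p k \<in> ?I k" if "?I k \<noteq> {}" for k
    using that unfolding p_def by (simp add: some_in_eq)
  have fin: "finite L" "finite R" by (auto simp: L_def R_def)
  have "?I 0 \<inter> {..Re z} \<noteq> {}"
    by (rule dom_interval_minimal_exponent) (use least H0 in auto)
  then have "0 \<in> L" using side[of 0] by (force simp: R_def)
  have "?I n \<inter> {Re z..} \<noteq> {}"
    by (rule dom_interval_maximal_exponent) (use greatest Hn in auto)
  then have "n \<in> R" using side[of n] by (force simp: L_def)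
  have "Max (p ` L) \<in> p ` L" using fin \<open>0 \<in> L\<close> by (intro Max_in) auto
  then obtain j where j: "j \<in> L" "p j = Max (p ` L)" by force
  have "Min (p ` R) \<in> p ` R" using fin \<open>n \<in> R\<close> by (intro Min_in) auto
  then obtain k where k: "k \<in> R" "p k = Min (p ` R)" by force
  have nothing_between: False
    if l: "l \<le> n" "?I l \<noteq> {}" and jl: "\<forall>a\<in>?I j. \<forall>b\<in>?I l. a < b" and lk: "\<forall>a\<in>?I l. \<forall>b\<in>?I k. a < b" for l
  proof -
    have pl: "p l \<in> ?I l" "p j \<in> ?I j" "p k \<in> ?I k"
      using p l(2) j(1) k(1) by (auto simp: L_def R_def)
    consider "l \<in> L" | "l \<in> R" using side l by blast
    then show False
    proof cases
      case 1
      then have "p l \<le> p j" using fin j(2) by simp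
      then show False using jl pl by force
    next
      case 2
      then have "p k \<le> p l" using fin k(2) by simp
      then show False using lk pl by force
    qed
  qed
  have "left_of (zero_free_region n w H j) (zero_free_region n w H k)"
    using j(1) k(1) by (force simp: left_of_zero_free_region_iff L_def R_def)
  moreover have "\<not> (\<exists>l\<le>n. zero_free_region n w H l \<noteq> {} \<and>
            left_of (zero_free_region n w H j) (zero_free_region n w H l) \<and>
            left_of (zero_free_region n w H l) (zero_free_region n w H k))"
    unfolding zero_free_region_empty_iff left_of_zero_free_region_iff using nothing_between by blast
  moreover have "j \<le> n" "k \<le> n" "zero_free_region n w H j \<noteq> {}" "zero_free_region n w H k \<noteq> {}"
    using j(1) k(1) by (simp_all add: L_def R_def zero_free_region_empty_iff)
  ultimately have nxt: "next_region n w H j k"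
    unfolding next_region_def by blast
  then have "z \<in> critical_strip n w H j k"
    using j(1) k(1) by (force simp: critical_strip_eq[OF nxt] L_def R_def)
  then show ?thesis
    using nxt by (auto simp: critical_strips_def adjacent_regions_def)
qed

text \<open>
  The vertical sides of the strip may carry zeros. Pushing them outwards to lines inside the
  adjacent zero-free regions adds no zeros, and makes the sides suitable for the argument principle.
\<close>

lemma critical_strip_zeros_eq_rectangle_zeros:
  assumes "w 0 = 0" and "H 0 = 1" and nxt: "next_region n w H j k"
    and a: "a \<in> dom_interval n w H j" and b: "b \<in> dom_interval n w H k"
  shows "{z \<in> {z \<in> critical_strip n w H j k. y1 \<le> Im z \<and> Im z \<le> y2}. exp_sum n w H z = 0}
       = {z \<in> cbox (Complex a y1) (Complex b y2). exp_sum n w H z = 0}" (is "?A = ?B")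
proof (rule antisym)
  show "?A \<subseteq> ?B"
    using a b by (auto simp: critical_strip_eq[OF nxt] in_cbox_complex_iff)
  have "a' \<le> Re z \<and> Re z \<le> b'"
    if z: "z \<in> ?B" and a': "a' \<in> dom_interval n w H j" and b': "b' \<in> dom_interval n w H k" for z a' b'
  proof -
    have jk: "j \<le> n" "k \<le> n" using nxt by (auto simp: next_region_def)
    have "\<not> Re z < a" "\<not> b < Re z"
      using z by (auto simp: in_cbox_complex_iff)
    moreover have "Re z \<notin> dom_interval n w H j"
      using exp_sum_nonzero_in_region[of w H, OF assms(1,2) jk(1)] z by blast
    moreover have "Re z \<notin> dom_interval n w H k"
      using exp_sum_nonzero_in_region[of w H, OF assms(1,2) jk(2)] z by blast
    ultimately show ?thesis
      using dom_interval_one_sided a b a' b' by (meson less_imp_le)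
  qed
  then have "z \<in> critical_strip n w H j k" if "z \<in> ?B" for z
    unfolding critical_strip_eq[OF nxt] using that by blast
  then show "?B \<subseteq> ?A"
    by (auto simp: in_cbox_complex_iff)
qed

lemma critical_strip_zero_count:
  assumes "w 0 = 0" and "H 0 = 1" and nxt: "next_region n w H j k"
  shows "\<exists>C. \<forall>y1 y2. y1 < y2 \<longrightarrow>
           (let R = {z \<in> critical_strip n w H j k. y1 \<le> Im z \<and> Im z \<le> y2}
            in finite {z \<in> R. exp_sum n w H z = 0} \<and>
               \<bar>real_of_int (zero_count (exp_sum n w H) R) - \<bar>w j - w k\<bar> / (2 * pi) * (y2 - y1)\<bar> \<le> C)"
proof -
  let ?f = "exp_sum n w H"
  have jk: "j \<le> n" "k \<le> n" "dom_interval n w H j \<noteq> {}" "dom_interval n w H k \<noteq> {}"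
    and left: "\<forall>a\<in>dom_interval n w H j. \<forall>b\<in>dom_interval n w H k. a < b"
    using nxt unfolding next_region_def zero_free_region_empty_iff left_of_zero_free_region_iff by auto
  obtain a b where a: "a \<in> dom_interval n w H j" and b: "b \<in> dom_interval n w H k"
    using jk by blast
  have ab: "a < b" and "j \<noteq> k" using left a b by auto
  then have wjk: "w j < w k" using dominant_exponent_increases[OF a b] jk by auto
  obtain c where c: "c > 0" "\<And>y. c \<le> cmod (?f (Complex a y))"
    using exp_sum_bounded_below_on_vertical_line[of w H, OF assms(1,2) jk(1) a] by blast
  have L: "Re (?f z / (H j * exp (w j * z))) > 0" if "Re z = a" for z :: complex
    by (rule Re_exp_sum_quotient_pos[of w H, OF assms(1,2) jk(1)]) (use a that in simp)
  have R: "Re (?f z / (H k * exp (w k * z))) > 0" if "Re z = b" for z :: complex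
    by (rule Re_exp_sum_quotient_pos[of w H, OF assms(1,2) jk(2)]) (use b that in simp)
  obtain C where C: "\<And>y1 y2. y1 < y2 \<Longrightarrow> \<bar>real_of_int (zero_count ?f (cbox (Complex a y1) (Complex b y2)))
      - (w k - w j) / (2 * pi) * (y2 - y1)\<bar> \<le> C"
    using zero_count_strip_asymptotics[OF exp_sum_holomorphic ab exp_sum_bounded_on_strip L R c] by blast
  have fa: "?f (Complex a 0) \<noteq> 0" using c(1) c(2)[of 0] by auto
  note zeros = critical_strip_zeros_eq_rectangle_zeros[of w H, OF assms a b]
  have "finite {z \<in> {z \<in> critical_strip n w H j k. y1 \<le> Im z \<and> Im z \<le> y2}. ?f z = 0}" for y1 y2
    unfolding zeros by (rule entire_finite_zeros_compact[OF exp_sum_holomorphic fa compact_cbox])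
  moreover have "zero_count ?f {z \<in> critical_strip n w H j k. y1 \<le> Im z \<and> Im z \<le> y2}
      = zero_count ?f (cbox (Complex a y1) (Complex b y2))" for y1 y2
    unfolding zero_count_def zeros ..
  ultimately show ?thesis
    using C wjk unfolding Let_def by (intro exI[of _ C]) auto
qed

lemma critical_strip_zero_count_adjacent:
  assumes "w 0 = 0" and "H 0 = 1" and adj: "adjacent_regions n w H j k"
  shows "\<exists>C. \<forall>y1 y2. y1 < y2 \<longrightarrow>
           (let R = {z \<in> critical_strip n w H j k. y1 \<le> Im z \<and> Im z \<le> y2}
            in finite {z \<in> R. exp_sum n w H z = 0} \<and>
               \<bar>real_of_int (zero_count (exp_sum n w H) R) - \<bar>w j - w k\<bar> / (2 * pi) * (y2 - y1)\<bar> \<le> C)"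
proof (cases "next_region n w H j k")
  case True
  then show ?thesis by (rule critical_strip_zero_count[of w H, OF assms(1,2)])
next
  case False
  then have "next_region n w H k j" using adj by (simp add: adjacent_regions_def)
  from critical_strip_zero_count[of w H, OF assms(1,2) this] show ?thesis
    by (simp only: critical_strip_commute[of n w H k j] abs_minus_commute[of "w k"])
qed

theorem theorem2p1:
  fixes n :: nat and w :: "nat \<Rightarrow> real" and H :: "nat \<Rightarrow> complex"
  assumes "n \<ge> 2"
    and "w 0 = 0" and "H 0 = 1"
    and "0 < w 1" and "strict_mono_on {1..n} w"
    and "\<And>k. k \<in> {1..n} \<Longrightarrow> H k \<noteq> 0"
  shows "finite (critical_strips n w H) \<and>
         {z. exp_sum n w H z = 0} \<subseteq> \<Union> (critical_strips n w H) \<and>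
         (\<exists>C::real. \<forall>j k. adjacent_regions n w H j k \<longrightarrow>
            (\<forall>y1 y2 r :: real. r > 0 \<and> y2 - y1 = r \<longrightarrow>
               (let R = {z \<in> critical_strip n w H j k. y1 \<le> Im z \<and> Im z \<le> y2}
                in finite {z \<in> R. exp_sum n w H z = 0} \<and>
                   \<bar>real_of_int (zero_count (exp_sum n w H) R) - \<bar>w j - w k\<bar> / (2 * pi) * r\<bar> \<le> C)))"
proof (intro conjI)
  have mono: "w i < w l" if "i < l" "l \<le> n" for i l
  proof (cases "i = 0")
    case True
    have "w 1 \<le> w l"
      using that assms(5) strict_mono_onD[OF assms(5), of 1 l] by (cases "l = 1") auto
    then show ?thesis using True assms(2,4) by simp
  next
    case False
    then show ?thesis using that strict_mono_onD[OF assms(5), of i l] by auto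
  qed
  show "finite (critical_strips n w H)" by (rule finite_critical_strips)
  show "{z. exp_sum n w H z = 0} \<subseteq> \<Union> (critical_strips n w H)"
    using assms(1,6) mono by (intro subsetI zeros_in_critical_strips[of w H, OF assms(2,3)]) auto
  define P where "P = (\<lambda>j k C. \<forall>y1 y2. y1 < y2 \<longrightarrow>
           (let R = {z \<in> critical_strip n w H j k. y1 \<le> Im z \<and> Im z \<le> y2}
            in finite {z \<in> R. exp_sum n w H z = 0} \<and>
               \<bar>real_of_int (zero_count (exp_sum n w H) R) - \<bar>w j - w k\<bar> / (2 * pi) * (y2 - y1)\<bar> \<le> C))"
  define A where "A = {(j, k). adjacent_regions n w H j k}"
  have finA: "finite A"
    by (rule finite_subset[of _ "{..n} \<times> {..n}"])
      (auto simp: A_def adjacent_regions_def next_region_def)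
  have "\<forall>q\<in>A. \<exists>C. P (fst q) (snd q) C"
    using critical_strip_zero_count_adjacent[of w H, OF assms(2,3)] by (auto simp: A_def P_def)
  then obtain C where C: "\<And>q. q \<in> A \<Longrightarrow> P (fst q) (snd q) (C q)"
    by (metis bchoice)
  have "P j k (Max (C ` A))" if "adjacent_regions n w H j k" for j k
  proof -
    have jk: "(j, k) \<in> A" using that by (simp add: A_def)
    then have "C (j, k) \<le> Max (C ` A)" using finA by simp
    then show ?thesis using C[OF jk] unfolding P_def Let_def by fastforce
  qed
  then show "\<exists>C::real. \<forall>j k. adjacent_regions n w H j k \<longrightarrow>
            (\<forall>y1 y2 r :: real. r > 0 \<and> y2 - y1 = r \<longrightarrow>
               (let R = {z \<in> critical_strip n w H j k. y1 \<le> Im z \<and> Im z \<le> y2}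
                in finite {z \<in> R. exp_sum n w H z = 0} \<and>
                   \<bar>real_of_int (zero_count (exp_sum n w H) R) - \<bar>w j - w k\<bar> / (2 * pi) * r\<bar> \<le> C))"
    unfolding P_def by (intro exI[of _ "Max (C ` A)"]) auto
qed

end
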